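(* Set $J_p:=J_x(\mathbf p)|_{\mathbf 0}\in\mathbb{R}^{n\times n}$, $R:=J_y(\mathbf q_1)|_{(\mathbf 0,\mathbf 0)}\in\mathbb{R}^{n\times m}$ and $W:=J_y(\mathbf q_2)|_{(\mathbf 0,\mathbf 0)}\in\mathbb{R}^{m\times m}$. Then for every $\Lambda\in\mathbb{R}^m$, $$A(\Lambda)=\begin{bmatrix}J_p&R\\0&D(\Lambda)\end{bmatrix},\qquad D(\Lambda):=W-\operatorname{diag}(\Lambda).$$ Consequently $\operatorname{eig}(A(\Lambda))=\operatorname{eig}(J_p)\cup\operatorname{eig}(D(\Lambda))$, counted with algebraic multiplicities. Since $\alpha_p>0$, $A(\Lambda)$ is Hurwitz if and only if $D(\Lambda)$ is Hurwitz. Moreover, the spectral margin of $A(\Lambda)$ satisfies $$\alpha(\Lambda):=-\operatorname{Re}\lambda_1(A(\Lambda))=\min\{\alpha_p,\alpha_{\mathrm{aux}}(\Lambda)\},\qquad \alpha_{\mathrm{aux}}(\Lambda):=-\operatorname{Re}\lambda_1(D(\Lambda)).$$ When $m=0$, $A=J_p$ and one sets $\alpha_{\mathrm{aux}}=+\infty$. In particular, the gains leave the eigenvalues of $J_p$ in the spectrum unchanged, and $\alpha(\Lambda)\le\alpha_p$ for all $\Lambda$.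
   Context: Polynomial system: $\dot{\mathbf x}=\mathbf p(\mathbf x)$ with $\mathbf p\in\mathbb{R}[\mathbf x]^n$, $\mathbf p(\mathbf 0)=\mathbf 0$, and the standing assumption $\alpha_p:=-\operatorname{Re}\lambda_1(J_x(\mathbf p)|_{\mathbf 0})>0$. Here $\operatorname{Re}\lambda_1(M)$ is the largest real part of an eigenvalue of $M$, $\operatorname{eig}(M)$ is the spectrum, $J_x,J_y$ denote Jacobians in the indicated variables, and $M$ is Hurwitz if $\operatorname{Re}\lambda_1(M)<0$. Fixed lift: $m\ge0$, $N=n+m$, $\mathbf g=(g_1,\dots,g_m)$ with each $g_i$ a monomial in $\mathbf x$ of degree at least $2$; $\Phi(\mathbf x)=(\mathbf x,\mathbf g(\mathbf x))\in\mathbb{R}^N$; coordinates $\mathbf w=(\mathbf x,\mathbf y)\in\mathbb{R}^n\times\mathbb{R}^m$. The lift is inner-quadratic: for each $i$ a factorization $g_i=a_ib_i$ is fixed, with $a_i,b_i\in\{x_1,\dots,x_n,y_1,\dots,y_{i-1}\}$ (the identity holding after substituting $\mathbf y=\mathbf g(\mathbf x)$). The stabilizers are $h_i(\mathbf x,\mathbf y)=y_i-a_ib_i$. Reference extension: $\mathbf F_0=(\mathbf q_1,\mathbf q_2)$ with $\mathbf q_1\in\mathbb{R}[\mathbf x,\mathbf y]^n$, $\mathbf q_2\in\mathbb{R}[\mathbf x,\mathbf y]^m$ of total degree at most two, satisfying $\mathbf F_0(\Phi(\mathbf x))=J_x(\Phi)(\mathbf x)\,\mathbf p(\mathbf x)$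 for all $\mathbf x$; it is written $\mathbf F_0(\mathbf w)=A_0\mathbf w+H_0(\mathbf w\otimes\mathbf w)$ (it has no constant term). Stabilized family: for gains $\Lambda=(\lambda_1,\dots,\lambda_m)\in\mathbb{R}^m$, $\mathbf F_\Lambda=\mathbf F_0-\sum_{i=1}^m\lambda_i\mathbf e_{n+i}h_i$, i.e. $\dot{\mathbf x}=\mathbf q_1$, $\dot y_i=q_{2,i}-\lambda_ih_i$. Its linear part is $A(\Lambda)=A_0-\sum_{i=1}^m\lambda_i\mathbf e_{n+i}\mathbf e_{n+i}^{\top}$. *)

theory Defs
  imports
    "HOL-Library.Poly_Mapping"
    "HOL-Library.Extended_Real"
    "HOL-Library.Multiset"
    "HOL-Computational_Algebra.Fundamental_Theorem_Algebra"
    "HOL-Analysis.Derivative"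
    "Jordan_Normal_Form.Spectral_Radius"
begin

section \<open>Multivariate real polynomials\<close>

text \<open>
  A polynomial is a finitely supported map from exponent vectors to coefficients; its ring
  operations are those of \<^theory>\<open>HOL-Library.Poly_Mapping\<close>. Variables are numbered from 0. In
  polynomials over the coordinates \<open>w = (x, y)\<close>, the variables \<open>0, \<dots>, n - 1\<close> are the \<open>x\<close>'s and
  \<open>n, \<dots>, n + m - 1\<close> are the \<open>y\<close>'s; accordingly the components \<open>y\<close>, \<open>g\<close>, \<open>h\<close>, \<open>\<Lambda>\<close> are
  numbered \<open>0, \<dots>, m - 1\<close>.
\<close>

type_synonym mpoly = "(nat \<Rightarrow>\<^sub>0 nat) \<Rightarrow>\<^sub>0 real"

definition mvar :: "nat \<Rightarrow> mpoly" where
  "mvar i = Poly_Mapping.single (Poly_Mapping.single i 1) 1"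

definition mconst :: "real \<Rightarrow> mpoly" where
  "mconst c = Poly_Mapping.single 0 c"

definition mon_degree :: "(nat \<Rightarrow>\<^sub>0 nat) \<Rightarrow> nat" where
  "mon_degree s = (\<Sum>i\<in>Poly_Mapping.keys s. Poly_Mapping.lookup s i)"

definition total_degree :: "mpoly \<Rightarrow> nat" where
  "total_degree f = Max (insert 0 (mon_degree ` Poly_Mapping.keys f))"

definition polys_in :: "nat \<Rightarrow> mpoly set" where
  "polys_in k = {f. \<forall>s\<in>Poly_Mapping.keys f. Poly_Mapping.keys s \<subseteq> {..<k}}"

definition is_monomial :: "mpoly \<Rightarrow> bool" where
  "is_monomial f \<longleftrightarrow> (\<exists>s. f = Poly_Mapping.single s 1)"

definition mpeval :: "mpoly \<Rightarrow> real vec \<Rightarrow> real" where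
  "mpeval f v = (\<Sum>s\<in>Poly_Mapping.keys f. Poly_Mapping.lookup f s *
     (\<Prod>i\<in>Poly_Mapping.keys s. (v $ i) ^ Poly_Mapping.lookup s i))"

definition mpeval_vec :: "mpoly vec \<Rightarrow> real vec \<Rightarrow> real vec" where
  "mpeval_vec F v = map_vec (\<lambda>f. mpeval f v) F"

definition partial_deriv :: "mpoly \<Rightarrow> nat \<Rightarrow> real vec \<Rightarrow> real" where
  "partial_deriv f j v = deriv (\<lambda>t. mpeval f (v + t \<cdot>\<^sub>v unit_vec (dim_vec v) j)) 0"

text \<open>
  The Jacobian at \<open>v\<close> with respect to the block of \<open>k\<close> consecutive variables starting at number
  \<open>s\<close>: \<open>J_x\<close> is the block \<open>s = 0\<close>, \<open>k = n\<close> and \<open>J_y\<close> is the block \<open>s = n\<close>, \<open>k = m\<close>.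
\<close>

definition jacobian_block :: "mpoly vec \<Rightarrow> nat \<Rightarrow> nat \<Rightarrow> real vec \<Rightarrow> real mat" where
  "jacobian_block F s k v = mat (dim_vec F) k (\<lambda>(i, j). partial_deriv (F $ i) (s + j) v)"


section \<open>Spectra of real matrices\<close>

abbreviation cspectrum :: "real mat \<Rightarrow> complex set" where
  "cspectrum M \<equiv> spectrum (map_mat complex_of_real M)"

text \<open>The spectrum with algebraic multiplicities, i.e. orders of roots of the characteristic polynomial.\<close>

definition eig :: "real mat \<Rightarrow> complex multiset" where
  "eig M = proots (char_poly (map_mat complex_of_real M))"

text \<open>
  The largest real part of an eigenvalue. The empty matrix has no eigenvalues; its value is set
  to \<open>-\<infinity>\<close>, so that its spectral margin is \<open>+\<infinity>\<close> and it is Hurwitz.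
\<close>

definition Re_lambda1 :: "real mat \<Rightarrow> ereal" where
  "Re_lambda1 M = (if dim_row M = 0 then -\<infinity> else ereal (Max (Re ` cspectrum M)))"

definition hurwitz :: "real mat \<Rightarrow> bool" where
  "hurwitz M \<longleftrightarrow> Re_lambda1 M < 0"

definition spectral_margin :: "real mat \<Rightarrow> ereal" where
  "spectral_margin M = - Re_lambda1 M"


section \<open>Lifts, reference extensions and stabilized families\<close>

definition lift_map :: "nat \<Rightarrow> mpoly vec \<Rightarrow> mpoly vec" where
  "lift_map n g = vec n mvar @\<^sub>v g"

text \<open>
  The factors \<open>a\<^sub>i\<close>, \<open>b\<^sub>i\<close> are given by their variable numbers: \<open>a i < n + i\<close> says that the factor
  is one of the \<open>x\<close>'s or a \<open>y\<close> with a smaller number than \<open>y\<^sub>i\<close>. Substituting \<open>y = g(x)\<close> into a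
  variable yields the corresponding component of \<open>\<Phi>\<close>.
\<close>

definition inner_quadratic_lift ::
  "nat \<Rightarrow> nat \<Rightarrow> mpoly vec \<Rightarrow> (nat \<Rightarrow> nat) \<Rightarrow> (nat \<Rightarrow> nat) \<Rightarrow> bool" where
  "inner_quadratic_lift n m g a b \<longleftrightarrow>
     dim_vec g = m \<and>
     (\<forall>i<m. is_monomial (g $ i) \<and> g $ i \<in> polys_in n \<and> 2 \<le> total_degree (g $ i)) \<and>
     (\<forall>i<m. a i < n + i \<and> b i < n + i \<and>
            g $ i = lift_map n g $ a i * lift_map n g $ b i)"

definition stabilizer :: "nat \<Rightarrow> (nat \<Rightarrow> nat) \<Rightarrow> (nat \<Rightarrow> nat) \<Rightarrow> nat \<Rightarrow> mpoly" where
  "stabilizer n a b i = mvar (n + i) - mvar (a i) * mvar (b i)"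

definition reference_extension ::
  "nat \<Rightarrow> nat \<Rightarrow> mpoly vec \<Rightarrow> mpoly vec \<Rightarrow> mpoly vec \<Rightarrow> mpoly vec \<Rightarrow> bool" where
  "reference_extension n m p g q1 q2 \<longleftrightarrow>
     dim_vec q1 = n \<and> dim_vec q2 = m \<and>
     (\<forall>i<n. q1 $ i \<in> polys_in (n + m) \<and> total_degree (q1 $ i) \<le> 2) \<and>
     (\<forall>i<m. q2 $ i \<in> polys_in (n + m) \<and> total_degree (q2 $ i) \<le> 2) \<and>
     (\<forall>x\<in>carrier_vec n.
        mpeval_vec (q1 @\<^sub>v q2) (mpeval_vec (lift_map n g) x) =
        jacobian_block (lift_map n g) 0 n x *\<^sub>v mpeval_vec p x)"

definition stabilized_field ::
  "nat \<Rightarrow> nat \<Rightarrow> (nat \<Rightarrow> nat) \<Rightarrow> (nat \<Rightarrow> nat) \<Rightarrow> mpoly vec \<Rightarrow> mpoly vec \<Rightarrow> real vec \<Rightarrow> mpoly vec" where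
  "stabilized_field n m a b q1 q2 \<Lambda> =
     q1 @\<^sub>v vec m (\<lambda>i. q2 $ i - mconst (\<Lambda> $ i) * stabilizer n a b i)"

definition kron_vec :: "real vec \<Rightarrow> real vec \<Rightarrow> real vec" where
  "kron_vec v w =
     vec (dim_vec v * dim_vec w) (\<lambda>k. v $ (k div dim_vec w) * w $ (k mod dim_vec w))"

text \<open>\<open>F(w) = A w + H (w \<otimes> w)\<close> on \<open>\<real>\<^sup>N\<close>; such an \<open>A\<close> is unique and is the linear part of \<open>F\<close>.\<close>

definition linear_quadratic_form :: "nat \<Rightarrow> mpoly vec \<Rightarrow> real mat \<Rightarrow> real mat \<Rightarrow> bool" where
  "linear_quadratic_form N F A H \<longleftrightarrow>
     A \<in> carrier_mat N N \<and> H \<in> carrier_mat N (N * N) \<and>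
     (\<forall>w\<in>carrier_vec N. mpeval_vec F w = A *\<^sub>v w + H *\<^sub>v kron_vec w w)"

definition linear_part_family :: "nat \<Rightarrow> nat \<Rightarrow> real mat \<Rightarrow> real vec \<Rightarrow> real mat" where
  "linear_part_family n m A0 \<Lambda> = A0 - mat (n + m) (n + m) (\<lambda>(k, l).
     \<Sum>i<m. \<Lambda> $ i * (unit_vec (n + m) (n + i) $ k * unit_vec (n + m) (n + i) $ l))"

definition aux_block :: "nat \<Rightarrow> real mat \<Rightarrow> real vec \<Rightarrow> real mat" where
  "aux_block m W \<Lambda> = W - mat_diag m (\<lambda>i. \<Lambda> $ i)"

end

theory Submission
  imports Defs
begin

text \<open>
  The linear part of a field \<open>F(w) = A w + H (w \<otimes> w)\<close> is its derivative at the origin: if a curve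
  \<open>w(t)\<close> starts at 0 with velocity \<open>d\<close>, then \<open>F(w(t))\<close> has velocity \<open>A d\<close>, because the quadratic term
  vanishes to second order. The matrix \<open>A0\<close> can therefore be read off along well-chosen curves.

  The straight line along a \<open>y\<close>-axis gives the right block column, which consists of the Jacobians
  \<open>R\<close> and \<open>W\<close>. For the left block column the curve is \<open>\<Phi>(t e\<^sub>j)\<close>. Every \<open>g\<^sub>i\<close> has degree at least
  two, so the \<open>y\<close>-part of this curve has velocity 0 and \<open>F\<^sub>0(\<Phi>(t e\<^sub>j))\<close> has velocity \<open>A0 e\<^sub>j\<close>. The
  invariance identity equates this with the velocity of \<open>J_x(\<Phi>)(t e\<^sub>j) p(t e\<^sub>j)\<close>. Its upper rows
  are \<open>p(t e\<^sub>j)\<close> itself, which yields \<open>J\<^sub>p\<close>. Its lower rows are \<open>\<nabla>g\<^sub>i(t e\<^sub>j) \<cdot> p(t e\<^sub>j)\<close>, a product of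
  a factor tending to 0 with a factor that is \<open>O(t)\<close>, which yields 0
  (\<open>extension_left_columns\<close>).

  A stabilizer \<open>y\<^sub>i - a\<^sub>i b\<^sub>i\<close> has linear part \<open>y\<^sub>i\<close>, so the gains only change the diagonal of the lower
  right block, and the matrix stays block upper triangular. Its characteristic polynomial is then
  the product of those of \<open>J\<^sub>p\<close> and \<open>D(\<Lambda>)\<close>, and all the spectral claims follow from this
  factorization; the Hurwitz equivalence uses in addition that \<open>J\<^sub>p\<close> has positive margin.
\<close>


section \<open>Evaluating polynomials\<close>

text \<open>
  Two polynomials can only be compared term by term after both sums are extended to a common set
  of exponent vectors.
\<close>

lemma mpeval_superset:
  assumes "finite S" "Poly_Mapping.keys f \<subseteq> S"
  shows "mpeval f v = (\<Sum>s\<in>S. Poly_Mapping.lookup f s *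
     (\<Prod>i\<in>Poly_Mapping.keys s. (v $ i) ^ Poly_Mapping.lookup s i))"
  unfolding mpeval_def
  by (rule sum.mono_neutral_left) (use assms in \<open>auto simp: in_keys_iff\<close>)

lemma mpeval_diff: "mpeval (f - f') v = mpeval f v - mpeval f' v"
proof -
  let ?S = "Poly_Mapping.keys f \<union> Poly_Mapping.keys f'"
  have "Poly_Mapping.keys (f - f') \<subseteq> ?S" by (rule keys_diff)
  then show ?thesis
    by (simp add: mpeval_superset[of ?S] lookup_minus left_diff_distrib sum_subtractf)
qed

lemma mpeval_single:
  assumes "Poly_Mapping.keys s \<subseteq> {..<k}"
  shows "mpeval (Poly_Mapping.single s c) v = c * (\<Prod>i<k. (v $ i) ^ Poly_Mapping.lookup s i)"
proof -
  have "(\<Prod>i\<in>Poly_Mapping.keys s. (v $ i) ^ Poly_Mapping.lookup s i)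
      = (\<Prod>i<k. (v $ i) ^ Poly_Mapping.lookup s i)"
    by (rule prod.mono_neutral_left) (use assms in \<open>auto simp: in_keys_iff\<close>)
  then show ?thesis by (simp add: mpeval_def)
qed

lemma mpeval_mvar [simp]: "mpeval (mvar i) v = v $ i"
  by (simp add: mpeval_def mvar_def)

lemma mpeval_stabilizer_term:
  "mpeval (mconst c * stabilizer n a b i) v = c * (v $ (n + i) - v $ a i * v $ b i)"
proof -
  let ?e = "\<lambda>j. Poly_Mapping.single j (1::nat)"
  have poly: "mconst c * stabilizer n a b i
      = Poly_Mapping.single (?e (n + i)) c - Poly_Mapping.single (?e (a i) + ?e (b i)) c"
    by (simp add: stabilizer_def mconst_def mvar_def right_diff_distrib mult_single)
  define k where "k = Suc (max (a i) (b i))"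
  have "Poly_Mapping.keys (?e (a i) + ?e (b i)) \<subseteq> {..<k}"
    using keys_add[of "?e (a i)" "?e (b i)"] by (auto simp: k_def split: if_splits)
  then have "mpeval (Poly_Mapping.single (?e (a i) + ?e (b i)) c) v
      = c * (\<Prod>j<k. v $ j ^ Poly_Mapping.lookup (?e (a i) + ?e (b i)) j)"
    by (rule mpeval_single)
  also have "(\<Prod>j<k. v $ j ^ Poly_Mapping.lookup (?e (a i) + ?e (b i)) j)
      = (\<Prod>j<k. (if j = a i then v $ j else 1) * (if j = b i then v $ j else 1))"
    by (rule prod.cong) (auto simp: lookup_add lookup_single when_def power_add)
  also have "\<dots> = v $ a i * v $ b i"
    by (simp add: prod.distrib prod.delta k_def)
  finally have quadratic:
    "mpeval (Poly_Mapping.single (?e (a i) + ?e (b i)) c) v = c * (v $ a i * v $ b i)" .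
  have "mpeval (Poly_Mapping.single (?e (n + i)) c) v = c * v $ (n + i)"
    by (simp add: mpeval_def)
  with quadratic show ?thesis
    by (simp add: poly mpeval_diff algebra_simps)
qed


section \<open>Monomials of degree at least two\<close>

lemma mpeval_single_has_derivative:
  assumes s: "Poly_Mapping.keys s \<subseteq> {..<n}" and v: "v \<in> carrier_vec n" and k: "k < n"
  shows "((\<lambda>t. mpeval (Poly_Mapping.single s 1) (v + t \<cdot>\<^sub>v unit_vec n k)) has_real_derivative
     real (Poly_Mapping.lookup s k) * v $ k ^ (Poly_Mapping.lookup s k - 1)
       * (\<Prod>i\<in>{..<n}-{k}. v $ i ^ Poly_Mapping.lookup s i)) (at 0)"
proof -
  let ?C = "\<Prod>i\<in>{..<n}-{k}. v $ i ^ Poly_Mapping.lookup s i"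
  have "mpeval (Poly_Mapping.single s 1) (v + t \<cdot>\<^sub>v unit_vec n k)
      = (v $ k + t) ^ Poly_Mapping.lookup s k * ?C" for t
  proof -
    have "(\<Prod>i\<in>{..<n}-{k}. (v + t \<cdot>\<^sub>v unit_vec n k) $ i ^ Poly_Mapping.lookup s i) = ?C"
      by (rule prod.cong) (use v k in \<open>auto simp: unit_vec_def\<close>)
    then show ?thesis
      using v k by (simp add: mpeval_single[OF s] prod.remove[of "{..<n}" k])
  qed
  then show ?thesis
    by (auto intro!: derivative_eq_intros)
qed

text \<open>
  The left-hand side is the preceding derivative formula at the origin. If the exponent of
  \<open>x\<^sub>k\<close> is 1, the power of \<open>x\<^sub>k\<close> becomes \<open>0 ^ 0 = 1\<close>, and the degree condition provides another
  variable that makes the product vanish.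
\<close>

lemma high_degree_monomial_gradient_zero:
  assumes s: "Poly_Mapping.keys s \<subseteq> {..<n}" and deg: "2 \<le> mon_degree s" and k: "k < n"
  shows "real (Poly_Mapping.lookup s k) * 0 ^ (Poly_Mapping.lookup s k - 1)
       * (\<Prod>i\<in>{..<n}-{k}. 0 ^ Poly_Mapping.lookup s i) = (0::real)"
proof -
  have "mon_degree s = (\<Sum>i<n. Poly_Mapping.lookup s i)"
    unfolding mon_degree_def by (rule sum.mono_neutral_left) (use s in \<open>auto simp: in_keys_iff\<close>)
  also have "\<dots> = Poly_Mapping.lookup s k + (\<Sum>i\<in>{..<n}-{k}. Poly_Mapping.lookup s i)"
    using k by (simp add: sum.remove)
  finally have sum: "2 \<le> Poly_Mapping.lookup s k + (\<Sum>i\<in>{..<n}-{k}. Poly_Mapping.lookup s i)"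
    using deg by simp
  consider "Poly_Mapping.lookup s k = 0" | "2 \<le> Poly_Mapping.lookup s k"
    | "Poly_Mapping.lookup s k = 1" by linarith
  then show ?thesis
  proof cases
    case 3
    with sum have "(\<Sum>i\<in>{..<n}-{k}. Poly_Mapping.lookup s i) \<noteq> 0" by linarith
    then obtain i where "i \<in> {..<n}-{k}" "Poly_Mapping.lookup s i \<noteq> 0"
      by (meson sum.neutral)
    then have "(\<Prod>i\<in>{..<n}-{k}. 0 ^ Poly_Mapping.lookup s i) = (0::real)"
      by (intro prod_zero) auto
    then show ?thesis by simp
  qed auto
qed

text \<open>
  The second fact says that the lifted coordinates contribute no velocity to \<open>\<Phi>(t e\<^sub>j)\<close>; the third
  makes the lower rows of \<open>J_x(\<Phi>)(t e\<^sub>j)\<close> negligible. The latter holds because a partial derivative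
  of a monomial is continuous and vanishes at the origin.
\<close>

lemma high_degree_monomial:
  assumes mono: "is_monomial f" and vars: "f \<in> polys_in n" and deg: "2 \<le> total_degree f"
    and j: "j < n"
  shows high_degree_monomial_zero: "mpeval f (0\<^sub>v n) = 0"
    and high_degree_monomial_along_axis:
      "((\<lambda>t. mpeval f (t \<cdot>\<^sub>v unit_vec n j)) has_real_derivative 0) (at 0)"
    and high_degree_monomial_partial_tendsto:
      "k < n \<Longrightarrow> (\<lambda>t. partial_deriv f k (t \<cdot>\<^sub>v unit_vec n j)) \<midarrow>0\<rightarrow> 0"
proof -
  obtain s where f: "f = Poly_Mapping.single s 1"
    using mono by (auto simp: is_monomial_def)
  have s: "Poly_Mapping.keys s \<subseteq> {..<n}" using vars by (simp add: f polys_in_def)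
  have deg_s: "2 \<le> mon_degree s" using deg by (simp add: f total_degree_def)
  have "s \<noteq> 0" using deg_s by (auto simp: mon_degree_def)
  then obtain i where i: "i \<in> Poly_Mapping.keys s" by (metis all_not_in_conv keys_eq_empty)
  then have "i < n" using s by auto
  with i show "mpeval f (0\<^sub>v n) = 0"
    by (auto simp: f mpeval_single[OF s] in_keys_iff intro!: bexI[of _ i])
  have "((\<lambda>t. mpeval f (0\<^sub>v n + t \<cdot>\<^sub>v unit_vec n j)) has_real_derivative 0) (at 0)"
    unfolding f
    by (rule DERIV_cong[OF mpeval_single_has_derivative[OF s zero_carrier_vec j]])
      (use high_degree_monomial_gradient_zero[OF s deg_s j] j in \<open>simp cong: prod.cong\<close>)
  then show "((\<lambda>t. mpeval f (t \<cdot>\<^sub>v unit_vec n j)) has_real_derivative 0) (at 0)"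
    by simp
  assume k: "k < n"
  let ?d = "\<lambda>v. real (Poly_Mapping.lookup s k) * v $ k ^ (Poly_Mapping.lookup s k - 1)
       * (\<Prod>i\<in>{..<n}-{k}. v $ i ^ Poly_Mapping.lookup s i)"
  have pd: "partial_deriv f k (t \<cdot>\<^sub>v unit_vec n j) = ?d (t \<cdot>\<^sub>v unit_vec n j)" for t
    unfolding partial_deriv_def f
    using DERIV_imp_deriv[OF mpeval_single_has_derivative[OF s _ k, of "t \<cdot>\<^sub>v unit_vec n j"]] by simp
  have "isCont (\<lambda>t. ?d (t \<cdot>\<^sub>v unit_vec n j)) 0"
  proof -
    have "isCont (\<lambda>t. real (Poly_Mapping.lookup s k)
         * (t * unit_vec n j $ k) ^ (Poly_Mapping.lookup s k - 1)
         * (\<Prod>i\<in>{..<n}-{k}. (t * unit_vec n j $ i) ^ Poly_Mapping.lookup s i)) 0"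
      by (intro continuous_intros)
    then show ?thesis using k by (simp cong: prod.cong_simp)
  qed
  moreover have "?d (0 \<cdot>\<^sub>v unit_vec n j) = 0"
    using high_degree_monomial_gradient_zero[OF s deg_s k] k by (simp cong: prod.cong)
  ultimately show "(\<lambda>t. partial_deriv f k (t \<cdot>\<^sub>v unit_vec n j)) \<midarrow>0\<rightarrow> 0"
    unfolding pd isCont_def by metis
qed


section \<open>The linear part as a derivative\<close>

text \<open>
  Position \<open>c\<close> of \<open>w \<otimes> w\<close> holds the product of the coordinates \<open>c div N\<close> and \<open>c mod N\<close>.
\<close>

lemma linear_quadratic_form_component:
  assumes "linear_quadratic_form N F A H" "dim_vec F = N" "i < N" "w \<in> carrier_vec N"
  shows "mpeval (F $ i) w = (\<Sum>l<N. A $$ (i, l) * w $ l)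
    + (\<Sum>c<N * N. H $$ (i, c) * (w $ (c div N) * w $ (c mod N)))"
proof -
  have A: "A \<in> carrier_mat N N" and H: "H \<in> carrier_mat N (N * N)"
    and "mpeval_vec F w = A *\<^sub>v w + H *\<^sub>v kron_vec w w"
    using assms by (auto simp: linear_quadratic_form_def)
  then have "mpeval (F $ i) w = (A *\<^sub>v w + H *\<^sub>v kron_vec w w) $ i"
    using assms by (metis index_map_vec(1) mpeval_vec_def)
  then show ?thesis
    using A H assms(3,4)
    by (simp add: scalar_prod_def kron_vec_def lessThan_atLeast0)
qed

text \<open>
  By the product rule a quadratic term has derivative 0 wherever both of its factors vanish.
  Allowing arbitrary curves through the origin covers both the coordinate axes and \<open>\<Phi>(t e\<^sub>j)\<close>.
\<close>

lemma linear_quadratic_form_has_derivative: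
  fixes w :: "real \<Rightarrow> real vec"
  assumes form: "linear_quadratic_form N F A H" "dim_vec F = N" "i < N"
    and w: "\<And>t. w t \<in> carrier_vec N" "w 0 = 0\<^sub>v N"
    and d: "\<And>l. l < N \<Longrightarrow> ((\<lambda>t. w t $ l) has_real_derivative d l) (at 0)"
  shows "((\<lambda>t. mpeval (F $ i) (w t)) has_real_derivative (\<Sum>l<N. A $$ (i, l) * d l)) (at 0)"
proof -
  have quad: "((\<lambda>t. w t $ (c div N) * w t $ (c mod N)) has_real_derivative 0) (at 0)"
    if "c < N * N" for c
  proof -
    have lt: "c div N < N" "c mod N < N"
      using that form(3) by (auto simp: less_mult_imp_div_less)
    show ?thesis
      using DERIV_mult[OF d[OF lt(1)] d[OF lt(2)]] w(2) lt by simp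
  qed
  have lin: "((\<lambda>t. \<Sum>l<N. A $$ (i, l) * w t $ l) has_real_derivative (\<Sum>l<N. A $$ (i, l) * d l)) (at 0)"
    by (intro DERIV_sum DERIV_cmult d) simp
  have "((\<lambda>t. \<Sum>c<N * N. H $$ (i, c) * (w t $ (c div N) * w t $ (c mod N)))
      has_real_derivative (\<Sum>c<N * N. H $$ (i, c) * 0)) (at 0)"
    by (intro DERIV_sum DERIV_cmult quad) simp
  from DERIV_add[OF lin this] show ?thesis
    by (simp add: linear_quadratic_form_component[OF form w(1)])
qed

lemma linear_quadratic_form_partial_deriv:
  assumes form: "linear_quadratic_form N F A H" "dim_vec F = N" "i < N" and l: "l < N"
  shows "partial_deriv (F $ i) l (0\<^sub>v N) = A $$ (i, l)"
proof -
  let ?w = "\<lambda>t::real. t \<cdot>\<^sub>v unit_vec N l"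
  have w0: "?w 0 = 0\<^sub>v N" by (rule eq_vecI) auto
  have d: "((\<lambda>t. ?w t $ k) has_real_derivative (if k = l then 1 else 0)) (at 0)" if "k < N" for k
    using that l by (auto simp: unit_vec_def)
  have "((\<lambda>t. mpeval (F $ i) (?w t)) has_real_derivative A $$ (i, l)) (at 0)"
    using linear_quadratic_form_has_derivative[OF form _ w0 d] l
    by (simp add: if_distrib sum.delta cong: if_cong)
  then show ?thesis
    unfolding partial_deriv_def by (simp add: DERIV_imp_deriv)
qed


section \<open>The block structure of the linear part\<close>

lemma mpeval_lift_map:
  assumes "x \<in> carrier_vec n"
  shows "mpeval_vec (lift_map n g) x = x @\<^sub>v mpeval_vec g x"
  by (rule eq_vecI) (use assms in \<open>auto simp: mpeval_vec_def lift_map_def\<close>)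

lemma lift_map_index:
  "i < n + dim_vec g \<Longrightarrow> lift_map n g $ i = (if i < n then mvar i else g $ (i - n))"
  by (simp add: lift_map_def)

lemma partial_deriv_mvar:
  assumes "x \<in> carrier_vec n" "i < n" "k < n"
  shows "partial_deriv (mvar i) k x = (if i = k then 1 else 0)"
proof -
  have "((\<lambda>t. x $ i + t * (if i = k then 1 else 0)) has_real_derivative (if i = k then 1 else 0)) (at 0)"
    by (auto intro!: derivative_eq_intros)
  then show ?thesis
    unfolding partial_deriv_def using assms
    by (intro DERIV_imp_deriv) (simp add: unit_vec_def)
qed

text \<open>
  This is where the invariance identity enters. Differentiability of \<open>p\<close> along \<open>t e\<^sub>j\<close> comes from
  the identity itself: its upper rows express \<open>p(t e\<^sub>j)\<close> through \<open>F\<^sub>0(\<Phi>(t e\<^sub>j))\<close>, whose derivative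
  is known.
\<close>

lemma extension_left_columns:
  assumes p_dim: "dim_vec p = n" and p_zero: "mpeval_vec p (0\<^sub>v n) = 0\<^sub>v n"
    and lift: "inner_quadratic_lift n m g a b"
    and ref: "reference_extension n m p g q1 q2"
    and A0_H0: "linear_quadratic_form (n + m) (q1 @\<^sub>v q2) A0 H0"
    and j: "j < n"
  shows "i < n \<Longrightarrow> A0 $$ (i, j) = partial_deriv (p $ i) j (0\<^sub>v n)"
    and "i < m \<Longrightarrow> A0 $$ (n + i, j) = 0"
proof -
  let ?F = "q1 @\<^sub>v q2" and ?N = "n + m"
  let ?x = "\<lambda>t::real. t \<cdot>\<^sub>v unit_vec n j"
  let ?w = "\<lambda>t. ?x t @\<^sub>v mpeval_vec g (?x t)"
  have dims: "dim_vec q1 = n" "dim_vec q2 = m" "dim_vec g = m"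
    using ref lift unfolding reference_extension_def inner_quadratic_lift_def by blast+
  have g: "is_monomial (g $ i)" "g $ i \<in> polys_in n" "2 \<le> total_degree (g $ i)" if "i < m" for i
    using lift that unfolding inner_quadratic_lift_def by blast+
  have x0: "?x 0 = 0\<^sub>v n" by (rule eq_vecI) auto
  have w: "?w t \<in> carrier_vec ?N" for t
  proof (rule append_carrier_vec)
    show "?x t \<in> carrier_vec n" by simp
    show "mpeval_vec g (?x t) \<in> carrier_vec m"
      by (rule carrier_vecI) (simp add: dims(3) mpeval_vec_def)
  qed
  have w0: "?w 0 = 0\<^sub>v ?N"
    by (rule eq_vecI)
      (auto simp: x0 mpeval_vec_def dims high_degree_monomial_zero[OF g j])
  have d: "((\<lambda>t. ?w t $ l) has_real_derivative (if l = j then 1 else 0)) (at 0)" if "l < ?N" for l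
    using that j high_degree_monomial_along_axis[OF g j, of "l - n"]
    by (cases "l < n") (auto simp: mpeval_vec_def dims unit_vec_def)
  have DF: "((\<lambda>t. mpeval (?F $ i) (?w t)) has_real_derivative A0 $$ (i, j)) (at 0)"
    if "i < ?N" for i
  proof (rule DERIV_cong[OF linear_quadratic_form_has_derivative[OF A0_H0 _ that w w0 d]])
    show "(\<Sum>l<?N. A0 $$ (i, l) * (if l = j then 1 else 0)) = A0 $$ (i, j)"
      using j by (simp add: if_distrib[of "\<lambda>c. _ * c"] sum.delta cong: if_cong)
  qed (simp_all add: dims)
  have F_eq: "mpeval (?F $ i) (?w t)
      = (\<Sum>k<n. partial_deriv (lift_map n g $ i) k (?x t) * mpeval (p $ k) (?x t))"
    if i: "i < ?N" for i t
  proof -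
    have "mpeval_vec ?F (?w t) = jacobian_block (lift_map n g) 0 n (?x t) *\<^sub>v mpeval_vec p (?x t)"
      using ref by (simp add: reference_extension_def mpeval_lift_map)
    then have "mpeval_vec ?F (?w t) $ i
        = (jacobian_block (lift_map n g) 0 n (?x t) *\<^sub>v mpeval_vec p (?x t)) $ i" by simp
    moreover have "mpeval_vec ?F (?w t) $ i = mpeval (?F $ i) (?w t)"
      using i dims by (simp add: mpeval_vec_def del: index_append_vec(1))
    moreover have "dim_vec (lift_map n g) = ?N"
      using dims by (simp add: lift_map_def)
    ultimately show ?thesis
      using i p_dim
      by (simp add: mpeval_vec_def jacobian_block_def scalar_prod_def lessThan_atLeast0
          del: index_append_vec(1))
  qed
  have p_eq: "mpeval (?F $ i) (?w t) = mpeval (p $ i) (?x t)" if "i < n" for i t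
  proof -
    have "mpeval (?F $ i) (?w t) = (\<Sum>k<n. if k = i then mpeval (p $ k) (?x t) else 0)"
      unfolding F_eq[OF trans_less_add1[OF that]]
      by (rule sum.cong) (use that in \<open>auto simp: lift_map_index partial_deriv_mvar[where n = n]\<close>)
    then show ?thesis using that by (simp add: sum.delta)
  qed
  have Dp: "((\<lambda>t. mpeval (p $ i) (?x t)) has_real_derivative A0 $$ (i, j)) (at 0)"
    if "i < n" for i
    using DF[OF trans_less_add1[OF that]] unfolding p_eq[OF that] .
  show "A0 $$ (i, j) = partial_deriv (p $ i) j (0\<^sub>v n)" if "i < n"
    using DERIV_imp_deriv[OF Dp[OF that]] by (simp add: partial_deriv_def)
  have p0: "mpeval (p $ k) (?x 0) = 0" if "k < n" for k
    using arg_cong[OF p_zero, of "\<lambda>v. v $ k"] that p_dim unfolding x0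
    by (simp add: mpeval_vec_def)
  assume i: "i < m"
  let ?r = "\<lambda>t. \<Sum>k<n. partial_deriv (g $ i) k (?x t) * mpeval (p $ k) (?x t)"
  have r: "mpeval (?F $ (n + i)) (?w t) = ?r t" for t
    using F_eq[of "n + i" t] i dims by (simp add: lift_map_index del: index_append_vec(1))
  have "(?r has_real_derivative A0 $$ (n + i, j)) (at 0)"
    using DF[of "n + i"] i unfolding r by simp
  then have "(\<lambda>t. (?r t - ?r 0) / (t - 0)) \<midarrow>0\<rightarrow> A0 $$ (n + i, j)"
    by (simp add: DERIV_def)
  \<comment> \<open>The product rule would need the partial derivatives of \<open>g\<^sub>i\<close> to be differentiable. Dividing
    only the factor \<open>p\<^sub>k\<close>, which vanishes at 0, by \<open>t\<close> needs no more than their limit.\<close>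
  moreover have "(\<lambda>t. (?r t - ?r 0) / (t - 0)) \<midarrow>0\<rightarrow> 0"
  proof -
    have "(\<lambda>t. \<Sum>k<n. partial_deriv (g $ i) k (?x t)
        * ((mpeval (p $ k) (?x t) - mpeval (p $ k) (?x 0)) / (t - 0)))
      \<midarrow>0\<rightarrow> (\<Sum>k<n. 0 * A0 $$ (k, j))"
      using Dp unfolding has_field_derivative_iff
      by (intro tendsto_sum tendsto_mult high_degree_monomial_partial_tendsto[OF g j] i) auto
    then show ?thesis
      by (simp add: p0 sum_divide_distrib)
  qed
  ultimately show "A0 $$ (n + i, j) = 0"
    by (rule LIM_unique)
qed

lemma reference_linear_part_blocks:
  assumes p_dim: "dim_vec p = n" and p_zero: "mpeval_vec p (0\<^sub>v n) = 0\<^sub>v n"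
    and lift: "inner_quadratic_lift n m g a b"
    and ref: "reference_extension n m p g q1 q2"
    and A0_H0: "linear_quadratic_form (n + m) (q1 @\<^sub>v q2) A0 H0"
  shows "A0 = four_block_mat (jacobian_block p 0 n (0\<^sub>v n)) (jacobian_block q1 n m (0\<^sub>v (n + m)))
    (0\<^sub>m m n) (jacobian_block q2 n m (0\<^sub>v (n + m)))"
proof -
  have A0: "A0 \<in> carrier_mat (n + m) (n + m)"
    using A0_H0 by (simp add: linear_quadratic_form_def)
  have dims: "dim_vec q1 = n" "dim_vec q2 = m"
    using ref unfolding reference_extension_def by blast+
  note left = extension_left_columns[OF assms]
  note pd = linear_quadratic_form_partial_deriv[OF A0_H0]
  show ?thesis
  proof (rule eq_matI)
    fix i j
    assume "i < dim_row (four_block_mat (jacobian_block p 0 n (0\<^sub>v n))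
        (jacobian_block q1 n m (0\<^sub>v (n + m))) (0\<^sub>m m n) (jacobian_block q2 n m (0\<^sub>v (n + m))))"
      and "j < dim_col (four_block_mat (jacobian_block p 0 n (0\<^sub>v n))
        (jacobian_block q1 n m (0\<^sub>v (n + m))) (0\<^sub>m m n) (jacobian_block q2 n m (0\<^sub>v (n + m))))"
    then have ij: "i < n + m" "j < n + m"
      by (simp_all add: jacobian_block_def p_dim dims)
    then show "A0 $$ (i, j) = four_block_mat (jacobian_block p 0 n (0\<^sub>v n))
        (jacobian_block q1 n m (0\<^sub>v (n + m))) (0\<^sub>m m n) (jacobian_block q2 n m (0\<^sub>v (n + m))) $$ (i, j)"
      using left(1)[of j i] left(2)[of j "i - n"] pd[of i j]
      by (cases "i < n"; cases "j < n") (auto simp: jacobian_block_def p_dim dims)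
  qed (use A0 in \<open>auto simp: jacobian_block_def p_dim dims\<close>)
qed

lemma linear_part_family_dim [simp]:
  "dim_row (linear_part_family n m A0 \<Lambda>) = n + m"
  "dim_col (linear_part_family n m A0 \<Lambda>) = n + m"
  by (simp_all add: linear_part_family_def)

lemma linear_part_family_index:
  assumes "A0 \<in> carrier_mat (n + m) (n + m)" "k < n + m" "l < n + m"
  shows "linear_part_family n m A0 \<Lambda> $$ (k, l)
    = A0 $$ (k, l) - (if n \<le> k \<and> k = l then \<Lambda> $ (k - n) else 0)"
proof -
  have "(\<Sum>i<m. \<Lambda> $ i * (unit_vec (n + m) (n + i) $ k * unit_vec (n + m) (n + i) $ l))
      = (\<Sum>i<m. if i = k - n then (if n \<le> k \<and> k = l then \<Lambda> $ (k - n) else 0) else 0)"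
    by (rule sum.cong) (use assms in \<open>auto simp: unit_vec_def\<close>)
  also have "\<dots> = (if n \<le> k \<and> k = l then \<Lambda> $ (k - n) else 0)"
    using assms by (auto simp: sum.delta)
  finally show ?thesis
    using assms by (simp add: linear_part_family_def)
qed

lemma linear_part_family_four_block:
  assumes "Jp \<in> carrier_mat n n" "R \<in> carrier_mat n m" "W \<in> carrier_mat m m"
  shows "linear_part_family n m (four_block_mat Jp R (0\<^sub>m m n) W) \<Lambda>
    = four_block_mat Jp R (0\<^sub>m m n) (aux_block m W \<Lambda>)"
proof -
  have "four_block_mat Jp R (0\<^sub>m m n) W \<in> carrier_mat (n + m) (n + m)"
    using assms by simp
  note index = linear_part_family_index[OF this]
  show ?thesis
    by (rule eq_matI)
      (use assms in \<open>auto simp: index aux_block_def mat_diag_def\<close>)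
qed

text \<open>
  The summand \<open>- \<lambda>\<^sub>i y\<^sub>i\<close> of the stabilization goes into the linear part, and \<open>\<lambda>\<^sub>i a\<^sub>i b\<^sub>i\<close> into the
  quadratic part, as a single entry in the column of \<open>w \<otimes> w\<close> that holds the product \<open>a\<^sub>i b\<^sub>i\<close>.
\<close>

lemma stabilized_field_linear_quadratic:
  assumes form: "linear_quadratic_form (n + m) (q1 @\<^sub>v q2) A0 H0"
    and dims: "dim_vec q1 = n" "dim_vec q2 = m"
    and factors: "\<And>i. i < m \<Longrightarrow> a i < n + i \<and> b i < n + i"
  shows "\<exists>H. linear_quadratic_form (n + m) (stabilized_field n m a b q1 q2 \<Lambda>)
    (linear_part_family n m A0 \<Lambda>) H"
proof -
  define N where "N = n + m"
  define G where "G = mat N (N * N)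
    (\<lambda>(r, c). if n \<le> r \<and> c = a (r - n) * N + b (r - n) then \<Lambda> $ (r - n) else 0)"
  let ?L = "linear_part_family n m A0 \<Lambda>" and ?F = "stabilized_field n m a b q1 q2 \<Lambda>"
  have A0: "A0 \<in> carrier_mat N N" and H0: "H0 \<in> carrier_mat N (N * N)"
    using form by (auto simp: linear_quadratic_form_def N_def)
  have G: "G \<in> carrier_mat N (N * N)"
    by (simp add: G_def)
  have "mpeval_vec ?F w = ?L *\<^sub>v w + (H0 + G) *\<^sub>v kron_vec w w" if w: "w \<in> carrier_vec N" for w
  proof (rule eq_vecI)
    fix r assume "r < dim_vec (?L *\<^sub>v w + (H0 + G) *\<^sub>v kron_vec w w)"
    then have r: "r < N" using G by simp
    have base: "mpeval ((q1 @\<^sub>v q2) $ r) w = row A0 r \<bullet> w + row H0 r \<bullet> kron_vec w w"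
      using linear_quadratic_form_component[OF form _ r[unfolded N_def] w[unfolded N_def]]
        r w A0 H0 dims
      by (simp add: scalar_prod_def kron_vec_def lessThan_atLeast0 N_def del: index_append_vec(1))
    have lin: "row ?L r \<bullet> w = row A0 r \<bullet> w - (if n \<le> r then \<Lambda> $ (r - n) * w $ r else 0)"
    proof -
      have "row ?L r \<bullet> w = (\<Sum>l<N. ?L $$ (r, l) * w $ l)"
        using r w by (simp add: N_def scalar_prod_def lessThan_atLeast0)
      also have "\<dots> = (\<Sum>l<N. A0 $$ (r, l) * w $ l
          - (if l = r then if n \<le> r then \<Lambda> $ (r - n) * w $ r else 0 else 0))"
        by (rule sum.cong)
          (use r A0 in \<open>auto simp: linear_part_family_index N_def algebra_simps\<close>)
      also have "\<dots> = (\<Sum>l<N. A0 $$ (r, l) * w $ l)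
          - (if n \<le> r then \<Lambda> $ (r - n) * w $ r else 0)"
        using r by (simp add: sum_subtractf sum.delta)
      finally show ?thesis
        using r w A0 by (simp add: scalar_prod_def lessThan_atLeast0)
    qed
    have quad: "row (H0 + G) r \<bullet> kron_vec w w = row H0 r \<bullet> kron_vec w w
        + (if n \<le> r then \<Lambda> $ (r - n) * (w $ a (r - n) * w $ b (r - n)) else 0)"
    proof -
      have "row G r \<bullet> kron_vec w w
          = (if n \<le> r then \<Lambda> $ (r - n) * (w $ a (r - n) * w $ b (r - n)) else 0)"
      proof (cases "n \<le> r")
        case True
        let ?c = "a (r - n) * N + b (r - n)"
        have ab: "a (r - n) < N" "b (r - n) < N"
          using factors[of "r - n"] r True unfolding N_def by linarith+
        have "?c < Suc (a (r - n)) * N" using ab(2) by simp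
        also have "\<dots> \<le> N * N" using ab(1) by (intro mult_le_mono1) simp
        finally have c: "?c < N * N" .
        have "row G r \<bullet> kron_vec w w = (\<Sum>c<N * N. if c = ?c
            then \<Lambda> $ (r - n) * (w $ (c div N) * w $ (c mod N)) else 0)"
          unfolding scalar_prod_def lessThan_atLeast0
          by (rule sum.cong) (use r w True in \<open>auto simp: G_def kron_vec_def\<close>)
        also have "\<dots> = \<Lambda> $ (r - n) * (w $ (?c div N) * w $ (?c mod N))"
          using c by (simp add: sum.delta)
        finally show ?thesis using True ab by simp
      next
        case False
        then show ?thesis
          using r w by (auto simp: scalar_prod_def G_def kron_vec_def intro!: sum.neutral)
      qed
      moreover have "row (H0 + G) r \<bullet> kron_vec w w
          = row H0 r \<bullet> kron_vec w w + row G r \<bullet> kron_vec w w"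
      proof -
        have "row H0 r \<in> carrier_vec (N * N)" "row G r \<in> carrier_vec (N * N)"
          using r H0 G by simp_all
        moreover have "kron_vec w w \<in> carrier_vec (N * N)"
          using w by (intro carrier_vecI) (simp add: kron_vec_def)
        moreover have "row (H0 + G) r = row H0 r + row G r"
          using r H0 G by simp
        ultimately show ?thesis by (simp only: add_scalar_prod_distrib)
      qed
      ultimately show ?thesis by simp
    qed
    have field: "mpeval_vec ?F w $ r = mpeval ((q1 @\<^sub>v q2) $ r) w
        - (if n \<le> r then \<Lambda> $ (r - n) * (w $ r - w $ a (r - n) * w $ b (r - n)) else 0)"
      using r dims by (auto simp: mpeval_vec_def stabilized_field_def N_def mpeval_diff
          mpeval_stabilizer_term)
    show "mpeval_vec ?F w $ r = (?L *\<^sub>v w + (H0 + G) *\<^sub>v kron_vec w w) $ r"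
    proof -
      have "(?L *\<^sub>v w + (H0 + G) *\<^sub>v kron_vec w w) $ r
          = row ?L r \<bullet> w + row (H0 + G) r \<bullet> kron_vec w w"
        using r G by (simp add: N_def)
      then show ?thesis
        unfolding field base lin quad by (cases "n \<le> r") (simp_all add: algebra_simps)
    qed
  qed (use G dims in \<open>auto simp: mpeval_vec_def stabilized_field_def N_def\<close>)
  moreover have "?L \<in> carrier_mat N N" "H0 + G \<in> carrier_mat N (N * N)"
    using G by (auto simp: N_def intro!: carrier_matI)
  ultimately show ?thesis
    unfolding linear_quadratic_form_def N_def by blast
qed


section \<open>Spectra of block triangular matrices\<close>

lemma char_poly_four_block_upper:
  fixes A B D :: "'a :: idom mat"
  assumes A: "A \<in> carrier_mat n n" and B: "B \<in> carrier_mat n m" and D: "D \<in> carrier_mat m m"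
  shows "char_poly (four_block_mat A B (0\<^sub>m m n) D) = char_poly A * char_poly D"
proof -
  let ?cm = "\<lambda>A :: 'a mat. [:0, 1:] \<cdot>\<^sub>m 1\<^sub>m (dim_row A) + map_mat (\<lambda>a. [:- a:]) A"
  have "?cm (four_block_mat A B (0\<^sub>m m n) D)
      = four_block_mat (?cm A) (map_mat (\<lambda>a. [:- a:]) B) (0\<^sub>m m n) (?cm D)"
    by (rule eq_matI) (use A B D in auto)
  moreover have "det \<dots> = det (?cm A) * det (?cm D)"
    by (rule det_four_block_mat_lower_left_zero[OF _ _ refl]) (use A B D in auto)
  ultimately show ?thesis
    unfolding char_poly_defs using A D by simp
qed

lemma char_poly_nonzero:
  "A \<in> carrier_mat n n \<Longrightarrow> char_poly (A :: 'a :: comm_ring_1 mat) \<noteq> 0"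
  using degree_monic_char_poly by force

context
  fixes A B D :: "real mat" and n m :: nat
  assumes A: "A \<in> carrier_mat n n" and B: "B \<in> carrier_mat n m" and D: "D \<in> carrier_mat m m"
begin

lemma char_poly_complex_four_block_upper:
  "char_poly (map_mat complex_of_real (four_block_mat A B (0\<^sub>m m n) D))
    = char_poly (map_mat complex_of_real A) * char_poly (map_mat complex_of_real D)"
proof -
  have "map_mat complex_of_real (four_block_mat A B (0\<^sub>m m n) D) = four_block_mat
     (map_mat complex_of_real A) (map_mat complex_of_real B) (0\<^sub>m m n) (map_mat complex_of_real D)"
    by (rule eq_matI) (use A B D in auto)
  then show ?thesis
    using A B D by (simp add: char_poly_four_block_upper)
qed

lemma eig_four_block_upper: "eig (four_block_mat A B (0\<^sub>m m n) D) = eig A + eig D"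
  unfolding eig_def char_poly_complex_four_block_upper
  by (rule proots_mult) (use A D in \<open>auto intro!: char_poly_nonzero\<close>)

lemma cspectrum_four_block_upper:
  "cspectrum (four_block_mat A B (0\<^sub>m m n) D) = cspectrum A \<union> cspectrum D"
proof -
  have root: "cspectrum M = {z. poly (char_poly (map_mat complex_of_real M)) z = 0}"
    if "M \<in> carrier_mat k k" for M k
    by (rule spectrum_root_char_poly) (use that in simp)
  have M: "four_block_mat A B (0\<^sub>m m n) D \<in> carrier_mat (n + m) (n + m)"
    using A D by simp
  show ?thesis
    unfolding root[OF M] root[OF A] root[OF D] char_poly_complex_four_block_upper by auto
qed

text \<open>
  The value \<open>-\<infinity>\<close> for the empty matrix is neutral for \<open>max\<close>, so the formula also covers empty
  diagonal blocks. They are treated separately because \<open>Max\<close> of the empty set is unspecified.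
\<close>

lemma Re_lambda1_four_block_upper:
  "Re_lambda1 (four_block_mat A B (0\<^sub>m m n) D) = max (Re_lambda1 A) (Re_lambda1 D)"
proof -
  have cA: "map_mat complex_of_real A \<in> carrier_mat n n"
    and cD: "map_mat complex_of_real D \<in> carrier_mat m m" using A D by auto
  have empty: "cspectrum M = {}" if "M \<in> carrier_mat k k" "k = 0" for M k
    using that eigenvalue_imp_nonzero_dim[of "map_mat complex_of_real M" k]
    by (auto simp: spectrum_def)
  consider "n = 0" | "m = 0" | "0 < n" "0 < m" by auto
  then show ?thesis
  proof cases
    case 3
    then have "Max (Re ` (cspectrum A \<union> cspectrum D))
        = max (Max (Re ` cspectrum A)) (Max (Re ` cspectrum D))"
      unfolding image_Un using spectrum_non_empty[OF cA] spectrum_non_empty[OF cD]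
        card_finite_spectrum(1)[OF cA] card_finite_spectrum(1)[OF cD]
      by (intro Max_Un) auto
    then show ?thesis
      using 3 A D by (simp add: Re_lambda1_def cspectrum_four_block_upper)
  qed (use A D empty[OF A] empty[OF D] cspectrum_four_block_upper in
      \<open>simp_all add: Re_lambda1_def\<close>)
qed

lemma spectral_margin_four_block_upper:
  "spectral_margin (four_block_mat A B (0\<^sub>m m n) D) = min (spectral_margin A) (spectral_margin D)"
  unfolding spectral_margin_def Re_lambda1_four_block_upper
  by (cases "Re_lambda1 A \<le> Re_lambda1 D") (auto simp: max_def min_def)

end

lemma hurwitz_iff_spectral_margin: "hurwitz M \<longleftrightarrow> 0 < spectral_margin M"
  by (simp add: hurwitz_def spectral_margin_def ereal_uminus_less_reorder)

theorem lemma3p1: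
  fixes n m :: nat
    and p g q1 q2 :: "mpoly vec"
    and a b :: "nat \<Rightarrow> nat"
    and A0 H0 Jp R W :: "real mat"
  assumes p_dim: "dim_vec p = n"
    and p_poly: "\<forall>i<n. p $ i \<in> polys_in n"
    and p_zero: "mpeval_vec p (0\<^sub>v n) = 0\<^sub>v n"
    and Jp_def: "Jp = jacobian_block p 0 n (0\<^sub>v n)"
    and margin_p: "spectral_margin Jp > 0"
    and lift: "inner_quadratic_lift n m g a b"
    and ref: "reference_extension n m p g q1 q2"
    and A0_H0: "linear_quadratic_form (n + m) (q1 @\<^sub>v q2) A0 H0"
    and R_def: "R = jacobian_block q1 n m (0\<^sub>v (n + m))"
    and W_def: "W = jacobian_block q2 n m (0\<^sub>v (n + m))"
  shows "\<forall>\<Lambda>\<in>carrier_vec m.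
    let A = linear_part_family n m A0 \<Lambda>; D = aux_block m W \<Lambda> in
      (\<exists>H. linear_quadratic_form (n + m) (stabilized_field n m a b q1 q2 \<Lambda>) A H) \<and>
      A = four_block_mat Jp R (0\<^sub>m m n) D \<and>
      eig A = eig Jp + eig D \<and>
      cspectrum A = cspectrum Jp \<union> cspectrum D \<and>
      (hurwitz A \<longleftrightarrow> hurwitz D) \<and>
      spectral_margin A = min (spectral_margin Jp) (spectral_margin D) \<and>
      (m = 0 \<longrightarrow> A = Jp \<and> spectral_margin D = \<infinity>) \<and>
      eig Jp \<subseteq># eig A \<and>
      spectral_margin A \<le> spectral_margin Jp"
proof -
  have dims: "dim_vec q1 = n" "dim_vec q2 = m"
    using ref unfolding reference_extension_def by blast+
  have factors: "a i < n + i \<and> b i < n + i" if "i < m" for i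
    using lift that unfolding inner_quadratic_lift_def by blast+
  have Jp: "Jp \<in> carrier_mat n n" and R: "R \<in> carrier_mat n m" and W: "W \<in> carrier_mat m m"
    using p_dim dims by (auto simp: Jp_def R_def W_def jacobian_block_def)
  have D: "aux_block m W \<Lambda> \<in> carrier_mat m m" for \<Lambda>
    by (rule carrier_matI) (simp_all add: aux_block_def mat_diag_def)
  have block: "linear_part_family n m A0 \<Lambda> = four_block_mat Jp R (0\<^sub>m m n) (aux_block m W \<Lambda>)" for \<Lambda>
    unfolding reference_linear_part_blocks[OF p_dim p_zero lift ref A0_H0, folded Jp_def R_def W_def]
    by (rule linear_part_family_four_block[OF Jp R W])
  have no_aux: "linear_part_family n m A0 \<Lambda> = Jp \<and> spectral_margin (aux_block m W \<Lambda>) = \<infinity>"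
    if "m = 0" for \<Lambda>
  proof
    show "linear_part_family n m A0 \<Lambda> = Jp"
      unfolding block by (rule eq_matI) (use that Jp D[of \<Lambda>] in auto)
    show "spectral_margin (aux_block m W \<Lambda>) = \<infinity>"
      using D[of \<Lambda>] that by (simp add: spectral_margin_def Re_lambda1_def)
  qed
  note margin = spectral_margin_four_block_upper[OF Jp R D]
  show ?thesis
    unfolding Let_def
  proof (intro ballI conjI)
    fix \<Lambda> :: "real vec"
    let ?A = "linear_part_family n m A0 \<Lambda>" and ?D = "aux_block m W \<Lambda>"
    show "\<exists>H. linear_quadratic_form (n + m) (stabilized_field n m a b q1 q2 \<Lambda>) ?A H"
      by (rule stabilized_field_linear_quadratic[OF A0_H0 dims factors])
    show "?A = four_block_mat Jp R (0\<^sub>m m n) ?D"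
      by (rule block)
    show eig: "eig ?A = eig Jp + eig ?D"
      unfolding block by (rule eig_four_block_upper[OF Jp R D])
    show "cspectrum ?A = cspectrum Jp \<union> cspectrum ?D"
      unfolding block by (rule cspectrum_four_block_upper[OF Jp R D])
    show "hurwitz ?A \<longleftrightarrow> hurwitz ?D"
      using margin_p by (simp add: hurwitz_iff_spectral_margin block margin)
    show "spectral_margin ?A = min (spectral_margin Jp) (spectral_margin ?D)"
      unfolding block by (rule margin)
    show "m = 0 \<longrightarrow> ?A = Jp \<and> spectral_margin ?D = \<infinity>"
      using no_aux by blast
    show "eig Jp \<subseteq># eig ?A"
      by (simp add: eig)
    show "spectral_margin ?A \<le> spectral_margin Jp"
      by (simp add: block margin)
  qed
qed

end
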